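(* Let $S$ be a zerosumfree semiring. Then the following statements hold: (1) If $M$ is a monoid, then $S[M]$ is an Armendariz $S$-semialgebra. (2) If $X_1,\dots,X_n$ are indeterminates over $S$, then the formal power series semiring $S[[X_1,\dots,X_n]]$ is an Armendariz $S$-semialgebra. Here Armendariz means: for all elements $f,g$ of the semialgebra, $fg=0$ implies $A_fA_g=(0)$, where $A_f$ denotes the ideal of $S$ generated by all coefficients of $f$.
   Context: A semiring is a set $S$ with operations $+,\cdot$ such that $(S,+,0)$ and $(S,\cdot,1)$ are commutative monoids with $1\neq 0$, multiplication distributes over addition, and $s\cdot 0=0$ for all $s$. An ideal of $S$ is a nonempty subset closed under addition and under multiplication by elements of $S$; $IJ$ is the ideal of finite sums of products $xy$, $x\in I$, $y\in J$. $S$ is zerosumfree if $a+b=0$ implies $a=b=0$ for all $a,b\in S$. All monoids are commutative and written additively; $S[M]$ is the monoid semiring, whose elements are finite formal sums $\sum_i s_iX^{m_i}$ with $s_i\in S$, $m_i\in M$, and $X^mX^{m'}=X^{m+m'}$. *)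

theory Defs
  imports "HOL-Library.Poly_Mapping"
begin

text \<open>
  Semirings in the sense used here (commutative, with \<open>1 \<noteq> 0\<close> and absorbing \<open>0\<close>) are exactly the
  types of class \<open>comm_semiring_1\<close>.  The monoid semiring \<open>S[M]\<close> is the type \<open>'m \<Rightarrow>\<^sub>0 's\<close> of finitely
  supported functions with the convolution product, the element \<open>s X\<^sup>m\<close> being
  \<open>Poly_Mapping.single m s\<close>.
\<close>

subsection \<open>Ideals of semirings\<close>

definition semiring_ideal :: "'s::comm_semiring_1 set \<Rightarrow> bool" where
  "semiring_ideal I \<longleftrightarrow>
     I \<noteq> {} \<and> (\<forall>x\<in>I. \<forall>y\<in>I. x + y \<in> I) \<and> (\<forall>s. \<forall>x\<in>I. s * x \<in> I)"

definition ideal_gen :: "'s::comm_semiring_1 set \<Rightarrow> 's set" where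
  "ideal_gen A = \<Inter>{I. semiring_ideal I \<and> A \<subseteq> I}"

definition ideal_mult :: "'s::comm_semiring_1 set \<Rightarrow> 's set \<Rightarrow> 's set" where
  "ideal_mult I J =
     {\<Sum>i<n. x i * y i | (n::nat) x y. (\<forall>i<n. x i \<in> I) \<and> (\<forall>i<n. y i \<in> J)}"

subsection \<open>Armendariz semialgebras\<close>

text \<open>
  An \<open>S\<close>-semialgebra is a semiring \<open>B\<close> together with a semiring morphism \<open>\<iota> : S \<rightarrow> B\<close>; the scalar
  multiplication is \<open>s b = \<iota>(s) b\<close>.
\<close>

definition semialgebra :: "('s::comm_semiring_1 \<Rightarrow> 'b::comm_semiring_1) \<Rightarrow> bool" where
  "semialgebra \<iota> \<longleftrightarrow>
     \<iota> 0 = 0 \<and> \<iota> 1 = 1 \<and>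
     (\<forall>s t. \<iota> (s + t) = \<iota> s + \<iota> t) \<and> (\<forall>s t. \<iota> (s * t) = \<iota> s * \<iota> t)"

text \<open>
  The second argument assigns to an element of the semialgebra the set of its coefficients.
\<close>

definition armendariz_semialgebra ::
    "('s::comm_semiring_1 \<Rightarrow> 'b::comm_semiring_1) \<Rightarrow> ('b \<Rightarrow> 's set) \<Rightarrow> bool" where
  "armendariz_semialgebra \<iota> coeffs \<longleftrightarrow>
     semialgebra \<iota> \<and>
     (\<forall>f g. f * g = 0 \<longrightarrow>
        ideal_mult (ideal_gen (coeffs f)) (ideal_gen (coeffs g)) = {0})"

subsection \<open>Formal power series in finitely many indeterminates\<close>

text \<open>
  The indeterminates are indexed by the elements of the finite type \<open>'n\<close>; a monomial is its exponent
  vector, of type \<open>'n \<Rightarrow>\<^sub>0 nat\<close>.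
\<close>

typedef (overloaded) ('s, 'n::finite) mfps = "UNIV :: (('n \<Rightarrow>\<^sub>0 nat) \<Rightarrow> 's) set"
  morphisms mfps_nth Abs_mfps ..

setup_lifting type_definition_mfps

lemma finite_add_decomp:
  fixes k :: "'n::finite \<Rightarrow>\<^sub>0 nat"
  shows "finite {(i, j). i + j = k}"
proof -
  define F where "F = {f :: 'n \<Rightarrow> nat. \<forall>x. f x \<in> {..Max (range (Poly_Mapping.lookup k))}}"
  have "finite F"
    using finite_set_of_finite_funs[of "UNIV :: 'n set" "{..Max (range (Poly_Mapping.lookup k))}" 0]
    by (simp add: F_def)
  have bnd: "Poly_Mapping.lookup i x \<le> Max (range (Poly_Mapping.lookup k))" if "i + j = k" for i j x
  proof -
    have "Poly_Mapping.lookup i x \<le> Poly_Mapping.lookup k x"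
      using that by (auto simp: lookup_add)
    also have "\<dots> \<le> Max (range (Poly_Mapping.lookup k))" by (rule Max_ge) auto
    finally show ?thesis .
  qed
  have mem: "i \<in> Abs_poly_mapping ` F" if "i + j = k" for i j
    using bnd[OF that] by (intro image_eqI[of _ _ "Poly_Mapping.lookup i"]) (auto simp: F_def)
  have "{(i, j). i + j = k} \<subseteq> Abs_poly_mapping ` F \<times> Abs_poly_mapping ` F"
  proof (clarify, intro conjI SigmaI)
    fix i j assume "k = i + j"
    then show "i \<in> Abs_poly_mapping ` F" "j \<in> Abs_poly_mapping ` F"
      using mem[of i j] mem[of j i] by (simp_all add: add.commute)
  qed
  then show ?thesis
    by (rule finite_subset) (simp add: \<open>finite F\<close>)
qed

instantiation mfps :: (comm_semiring_1, finite) comm_semiring_1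
begin

lift_definition zero_mfps :: "('a, 'b) mfps" is "\<lambda>_. 0" .

lift_definition one_mfps :: "('a, 'b) mfps" is "\<lambda>k. if k = 0 then 1 else 0" .

lift_definition plus_mfps :: "('a, 'b) mfps \<Rightarrow> ('a, 'b) mfps \<Rightarrow> ('a, 'b) mfps"
  is "\<lambda>f g k. f k + g k" .

lift_definition times_mfps :: "('a, 'b) mfps \<Rightarrow> ('a, 'b) mfps \<Rightarrow> ('a, 'b) mfps"
  is "\<lambda>f g k. \<Sum>(i, j) \<in> {(i, j). i + j = k}. f i * g j" .

instance
proof
  fix a b c :: "('a, 'b) mfps"
  show "a + b + c = a + (b + c)" by transfer (simp add: add.assoc)
  show "a + b = b + a" by transfer (simp add: add.commute)
  show "0 + a = a" by transfer simp
  show "0 * a = 0" by transfer simp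
  show "a * 0 = 0" by transfer simp
  show "(0 :: ('a, 'b) mfps) \<noteq> 1" by transfer (metis zero_neq_one)
  show "(a + b) * c = a * c + b * c"
    by transfer (auto simp: distrib_right sum.distrib case_prod_unfold)
  show "a * b = b * a"
  proof transfer
    fix a b :: "('b \<Rightarrow>\<^sub>0 nat) \<Rightarrow> 'a"
    show "(\<lambda>k. \<Sum>(i, j) \<in> {(i, j). i + j = k}. a i * b j) =
          (\<lambda>k. \<Sum>(i, j) \<in> {(i, j). i + j = k}. b i * a j)"
      by (intro ext sum.reindex_bij_witness[of _ prod.swap prod.swap])
         (auto simp: add.commute mult.commute)
  qed
  show "1 * a = a"
  proof transfer
    fix a :: "('b \<Rightarrow>\<^sub>0 nat) \<Rightarrow> 'a"
    show "(\<lambda>k. \<Sum>(i, j) \<in> {(i, j). i + j = k}. (if i = 0 then 1 else 0) * a j) = a"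
    proof
      fix k
      have "(\<Sum>(i, j) \<in> {(i, j). i + j = k}. (if i = 0 then 1 else 0) * a j) =
            (\<Sum>(i, j) \<in> {(0 :: 'b \<Rightarrow>\<^sub>0 nat, k)}. (if i = 0 then 1 else 0) * a j)"
        by (rule sum.mono_neutral_right) (auto simp: finite_add_decomp split: if_splits)
      then show "(\<Sum>(i, j) \<in> {(i, j). i + j = k}. (if i = 0 then 1 else 0) * a j) = a k"
        by simp
    qed
  qed
  show "a * b * c = a * (b * c)"
  proof transfer
    fix a b c :: "('b \<Rightarrow>\<^sub>0 nat) \<Rightarrow> 'a"
    let ?D = "\<lambda>k :: 'b \<Rightarrow>\<^sub>0 nat. {(i, j). i + j = k}"
    show "(\<lambda>k. \<Sum>(i, j) \<in> ?D k. (\<Sum>(p, q) \<in> ?D i. a p * b q) * c j) =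
          (\<lambda>k. \<Sum>(i, j) \<in> ?D k. a i * (\<Sum>(p, q) \<in> ?D j. b p * c q))"
    proof
      fix k
      have "(\<Sum>(i, j) \<in> ?D k. (\<Sum>(p, q) \<in> ?D i. a p * b q) * c j) =
            (\<Sum>z \<in> ?D k. \<Sum>w \<in> ?D (fst z). a (fst w) * b (snd w) * c (snd z))"
        by (simp add: sum_distrib_right case_prod_unfold)
      also have "\<dots> = (\<Sum>(z, w) \<in> Sigma (?D k) (\<lambda>z. ?D (fst z)).
                        a (fst w) * b (snd w) * c (snd z))"
        by (rule sum.Sigma) (auto simp: finite_add_decomp)
      also have "\<dots> = (\<Sum>(z, w) \<in> Sigma (?D k) (\<lambda>z. ?D (snd z)).
                        a (fst z) * (b (fst w) * c (snd w)))"
        by (rule sum.reindex_bij_witness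
              [of _ "\<lambda>((i, j), (p, q)). ((i + p, q), (i, p))"
                    "\<lambda>((i, j), (p, q)). ((p, q + j), (q, j))"])
           (auto simp: add.assoc mult.assoc)
      also have "\<dots> = (\<Sum>z \<in> ?D k. \<Sum>w \<in> ?D (snd z). a (fst z) * (b (fst w) * c (snd w)))"
        by (rule sum.Sigma[symmetric]) (auto simp: finite_add_decomp)
      also have "\<dots> = (\<Sum>(i, j) \<in> ?D k. a i * (\<Sum>(p, q) \<in> ?D j. b p * c q))"
        by (simp add: sum_distrib_left case_prod_unfold)
      finally show "(\<Sum>(i, j) \<in> ?D k. (\<Sum>(p, q) \<in> ?D i. a p * b q) * c j) =
                    (\<Sum>(i, j) \<in> ?D k. a i * (\<Sum>(p, q) \<in> ?D j. b p * c q))" .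
    qed
  qed
qed

end

lift_definition mfps_const :: "'s::zero \<Rightarrow> ('s, 'n::finite) mfps"
  is "\<lambda>s k. if k = 0 then s else 0" .

end

theory Submission
  imports Defs
begin

text \<open>
  Every coefficient of \<open>f g\<close> is a finite sum of products of a coefficient of \<open>f\<close> and a coefficient of
  \<open>g\<close>, and every such product occurs as a summand of some coefficient of \<open>f g\<close>.  Over a zerosumfree
  semiring, \<open>f g = 0\<close> therefore kills all these products.  Since annihilators are ideals, the
  products of elements of the generated ideals vanish as well.
\<close>

lemma zerosumfree_sum_eq_0D:
  fixes f :: "'i \<Rightarrow> 's::comm_monoid_add"
  assumes zerosumfree: "\<And>a b :: 's. a + b = 0 \<Longrightarrow> a = 0 \<and> b = 0"
    and "finite A" "sum f A = 0" "i \<in> A"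
  shows "f i = 0"
proof -
  \<comment> \<open>Splitting off one summand leaves a sum of two terms, so zerosumfreeness applies
    at once, without induction on \<open>A\<close>.\<close>
  have "f i + sum f (A - {i}) = 0"
    using sum.remove[OF assms(2,4)] assms(3) by metis
  then show ?thesis using zerosumfree by blast
qed

lemma semiring_ideal_annihilator:
  fixes B :: "'s::comm_semiring_1 set"
  shows "semiring_ideal {x. \<forall>y\<in>B. x * y = 0}"
  unfolding semiring_ideal_def by (auto simp: distrib_right mult.assoc intro: exI[of _ 0])

text \<open>The annihilator of \<open>B\<close> is one of the ideals containing \<open>A\<close>
  over which the intersection \<open>ideal_gen A\<close> is taken.\<close>

lemma ideal_gen_annihilates:
  fixes A B :: "'s::comm_semiring_1 set"
  assumes "\<And>a b. a \<in> A \<Longrightarrow> b \<in> B \<Longrightarrow> a * b = 0"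
    and "x \<in> ideal_gen A" "b \<in> B"
  shows "x * b = 0"
proof -
  have "A \<subseteq> {x. \<forall>y\<in>B. x * y = 0}" using assms(1) by blast
  then have "ideal_gen A \<subseteq> {x. \<forall>y\<in>B. x * y = 0}"
    unfolding ideal_gen_def using semiring_ideal_annihilator by blast
  then show ?thesis using assms(2,3) by blast
qed

text \<open>The annihilator argument is used twice, passing from generators to the generated ideal
  in one factor at a time.\<close>

lemma ideal_mult_ideal_gen_eq_0:
  fixes A B :: "'s::comm_semiring_1 set"
  assumes "\<And>a b. a \<in> A \<Longrightarrow> b \<in> B \<Longrightarrow> a * b = 0"
  shows "ideal_mult (ideal_gen A) (ideal_gen B) = {0}"
proof -
  have "x * y = 0" if "x \<in> ideal_gen A" "y \<in> ideal_gen B" for x y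
  proof -
    have "b * x = 0" if "b \<in> B" for b
      using ideal_gen_annihilates[OF assms \<open>x \<in> ideal_gen A\<close> that] by (simp add: mult.commute)
    \<comment> \<open>Second pass: the roles are swapped, with \<open>B\<close> as generating set
      and the single element \<open>x\<close> to be annihilated.\<close>
    then have "y * x = 0"
      using ideal_gen_annihilates[of B "{x}" y x] \<open>y \<in> ideal_gen B\<close> by blast
    then show ?thesis by (simp add: mult.commute)
  qed
  then have "ideal_mult (ideal_gen A) (ideal_gen B) \<subseteq> {0}"
    unfolding ideal_mult_def by auto
  \<comment> \<open>The empty sum, with \<open>n = 0\<close>, witnesses membership of
    \<open>0\<close>.\<close>
  moreover have "0 \<in> ideal_mult (ideal_gen A) (ideal_gen B)"
    unfolding ideal_mult_def by (rule CollectI, rule exI[of _ 0]) auto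
  ultimately show ?thesis by blast
qed

text \<open>In an arbitrary monoid \<open>k\<close> may have infinitely many decompositions
  \<open>a + b\<close>; restricting to the supports gives an ordinary finite sum.\<close>

lemma lookup_times_eq_sum_keys:
  fixes f g :: "'m::comm_monoid_add \<Rightarrow>\<^sub>0 's::comm_semiring_1"
  shows "Poly_Mapping.lookup (f * g) k =
    (\<Sum>(a, b) \<in> Poly_Mapping.keys f \<times> Poly_Mapping.keys g.
       Poly_Mapping.lookup f a * Poly_Mapping.lookup g b when k = a + b)"
proof -
  have "Poly_Mapping.lookup (f * g) k =
      (\<Sum>(a, b). Poly_Mapping.lookup f a * Poly_Mapping.lookup g b when k = a + b)"
    by (simp add: times_poly_mapping.rep_eq prod_fun_unfold_prod)
  also have "\<dots> = (\<Sum>(a, b) \<in> Poly_Mapping.keys f \<times> Poly_Mapping.keys g.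
      Poly_Mapping.lookup f a * Poly_Mapping.lookup g b when k = a + b)"
    by (rule Sum_any.expand_superset) (auto simp: in_keys_iff when_def split: if_splits)
  finally show ?thesis .
qed

lemma poly_mapping_coeff_mult_eq_0:
  fixes f g :: "'m::comm_monoid_add \<Rightarrow>\<^sub>0 's::comm_semiring_1"
  assumes zerosumfree: "\<And>a b :: 's. a + b = 0 \<Longrightarrow> a = 0 \<and> b = 0"
    and "f * g = 0"
  shows "Poly_Mapping.lookup f i * Poly_Mapping.lookup g j = 0"
proof (cases "i \<in> Poly_Mapping.keys f \<and> j \<in> Poly_Mapping.keys g")
  case True
  \<comment> \<open>The coefficient at \<open>i + j\<close> is chosen because the condition
    \<open>i + j = a + b\<close> holds at the pair \<open>(i, j)\<close>. Other pairs may satisfy it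
    too, and zerosumfreeness separates the summands.\<close>
  have "(\<Sum>(a, b) \<in> Poly_Mapping.keys f \<times> Poly_Mapping.keys g.
      Poly_Mapping.lookup f a * Poly_Mapping.lookup g b when i + j = a + b) = 0"
    using lookup_times_eq_sum_keys[of f g "i + j"] \<open>f * g = 0\<close> by simp
  from zerosumfree_sum_eq_0D[OF zerosumfree _ this, of "(i, j)"] True show ?thesis
    by simp
next
  case False
  then show ?thesis by (auto simp: in_keys_iff)
qed

text \<open>Supports may be infinite here, but an exponent vector has only finitely many
  decompositions, so the sum over all of them is finite.\<close>

lemma mfps_coeff_mult_eq_0:
  fixes f g :: "('s::comm_semiring_1, 'n::finite) mfps"
  assumes zerosumfree: "\<And>a b :: 's. a + b = 0 \<Longrightarrow> a = 0 \<and> b = 0"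
    and "f * g = 0"
  shows "mfps_nth f i * mfps_nth g j = 0"
proof -
  have "(\<Sum>(a, b) \<in> {(a, b). a + b = i + j}. mfps_nth f a * mfps_nth g b) = 0"
    using arg_cong[OF \<open>f * g = 0\<close>, of "\<lambda>h. mfps_nth h (i + j)"]
    by (simp add: times_mfps.rep_eq zero_mfps.rep_eq)
  from zerosumfree_sum_eq_0D[OF zerosumfree finite_add_decomp this, of "(i, j)"] show ?thesis
    by simp
qed

lemma semialgebra_single:
  "semialgebra (Poly_Mapping.single 0 :: 's::comm_semiring_1 \<Rightarrow> ('m::comm_monoid_add \<Rightarrow>\<^sub>0 's))"
  by (simp add: semialgebra_def single_add mult_single)

lemma mfps_const_mult:
  fixes s t :: "'s::comm_semiring_1"
  shows "(mfps_const (s * t) :: ('s, 'n::finite) mfps) = mfps_const s * mfps_const t"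
proof transfer
  fix s t :: 's
  show "(\<lambda>k :: 'n \<Rightarrow>\<^sub>0 nat. if k = 0 then s * t else 0) =
    (\<lambda>k. \<Sum>(i, j) \<in> {(i, j). i + j = k}. (if i = 0 then s else 0) * (if j = 0 then t else 0))"
  proof
    fix k :: "'n \<Rightarrow>\<^sub>0 nat"
    \<comment> \<open>Every pair other than \<open>(0, k)\<close> has \<open>i\<close> nonzero and
      contributes nothing; for nonzero \<open>k\<close> the remaining term vanishes through its
      second factor.\<close>
    have "(\<Sum>(i, j) \<in> {(i, j). i + j = k}. (if i = 0 then s else 0) * (if j = 0 then t else 0)) =
      (\<Sum>(i, j) \<in> {(0 :: 'n \<Rightarrow>\<^sub>0 nat, k)}. (if i = 0 then s else 0) * (if j = 0 then t else 0))"
      by (rule sum.mono_neutral_right) (auto simp: finite_add_decomp split: if_splits)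
    then show "(if k = 0 then s * t else 0) =
      (\<Sum>(i, j) \<in> {(i, j). i + j = k}. (if i = 0 then s else 0) * (if j = 0 then t else 0))"
      by simp
  qed
qed

lemma semialgebra_mfps_const:
  "semialgebra (mfps_const :: 's::comm_semiring_1 \<Rightarrow> ('s, 'n::finite) mfps)"
  unfolding semialgebra_def
proof (intro conjI allI)
  show "(mfps_const 0 :: ('s, 'n) mfps) = 0" by transfer auto
  show "(mfps_const 1 :: ('s, 'n) mfps) = 1" by transfer auto
  show "(mfps_const (s + t) :: ('s, 'n) mfps) = mfps_const s + mfps_const t" for s t :: 's
    by transfer auto
  show "(mfps_const (s * t) :: ('s, 'n) mfps) = mfps_const s * mfps_const t" for s t :: 's
    by (rule mfps_const_mult)
qed

theorem theorem4p11:
  assumes zerosumfree: "\<And>a b :: 's::comm_semiring_1. a + b = 0 \<Longrightarrow> a = 0 \<and> b = 0"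
  shows "armendariz_semialgebra
           (Poly_Mapping.single 0 :: 's \<Rightarrow> ('m::comm_monoid_add \<Rightarrow>\<^sub>0 's))
           (\<lambda>f. range (Poly_Mapping.lookup f))
       \<and> armendariz_semialgebra
           (mfps_const :: 's \<Rightarrow> ('s, 'n::finite) mfps)
           (\<lambda>f. range (mfps_nth f))"
  unfolding armendariz_semialgebra_def
proof (intro conjI allI impI semialgebra_single semialgebra_mfps_const)
  fix f g :: "'m \<Rightarrow>\<^sub>0 's"
  assume "f * g = 0"
  then show "ideal_mult (ideal_gen (range (Poly_Mapping.lookup f)))
      (ideal_gen (range (Poly_Mapping.lookup g))) = {0}"
    \<comment> \<open>The generating sets are full ranges, including the value \<open>0\<close> off
      the support, which the coefficient lemma covers since its \<open>i\<close> and
      \<open>j\<close> are arbitrary.\<close>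
    using poly_mapping_coeff_mult_eq_0[OF zerosumfree] by (intro ideal_mult_ideal_gen_eq_0) blast
next
  fix f g :: "('s, 'n) mfps"
  assume "f * g = 0"
  then show "ideal_mult (ideal_gen (range (mfps_nth f))) (ideal_gen (range (mfps_nth g))) = {0}"
    using mfps_coeff_mult_eq_0[OF zerosumfree] by (intro ideal_mult_ideal_gen_eq_0) blast
qed

end
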